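(* Let $\Gamma<1$, $\beta\in[0,2-2\Gamma)$, and let $u_{\rm cp}(y)=\Gamma y+(1-\Gamma)y^2$ for $y\in[-1,1]$. If $(u(x-ct,y),v(x-ct,y))$, with profile $(u,v)\in C^2(D_L)$ and wave speed $c\in\mathbb R$, is a traveling-wave solution of the $\beta$-plane equation in $D_L=\mathbb T_L\times[-1,1]$ with $v=0$ on $y=\pm1$, and $$\|\Delta u-u_{\rm cp}''\|_{C^0(D_L)}<2-2\Gamma-\beta,$$ then $(u(x-ct,y),v(x-ct,y))$ is a shear flow.
   Context: Let $L>0$, $\mathbb T_L=\mathbb R/L\mathbb Z$. For a constant $\beta\ge0$, the $\beta$-plane equation on $D_L=\mathbb T_L\times[-1,1]$ is $$u_t+uu_x+vu_y-\beta yv=-P_x,\quad v_t+uv_x+vv_y+\beta yu=-P_y,\quad u_x+v_y=0,$$ with boundary condition $v=0$ on $y=\pm 1$ ($P$ is the pressure). A traveling-wave solution of speed $c\in\mathbb R$ is a solution (for some pressure) of the form $(u(x-ct,y),v(x-ct,y))$; $(u,v)\in C^2(D_L)$ means that the profiles are $L$-periodic in the first variable and $C^2$ up to the boundary. It is a shear flow if $v\equiv0$ on $D_L$ (so that $u$ depends only on $y$). $\|\cdot\|_{C^0}$ is the sup norm and $\Delta=\partial_x^2+\partial_y^2$. *)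

theory Defs
  imports "HOL-Analysis.Analysis"
begin

text \<open>
  A function on the channel with circumference \<open>L\<close> is represented by a function on
  \<open>real \<times> real\<close> that is \<open>L\<close>-periodic in the first variable on the strip below; its values
  off the strip are irrelevant.
\<close>

definition strip :: "(real \<times> real) set" where
  "strip = UNIV \<times> {-1..1}"

definition x_periodic :: "real \<Rightarrow> (real \<times> real \<Rightarrow> real) \<Rightarrow> bool" where
  "x_periodic L f \<longleftrightarrow> (\<forall>x. \<forall>y\<in>{-1..1}. f (x + L, y) = f (x, y))"

text \<open>
  Partial derivatives on the closed strip. At \<open>y = -1\<close> and \<open>y = 1\<close> the derivative in \<open>y\<close> is the
  one-sided one. Both operators are total, so wherever they are used the existence
  of the derivative is required separately.
\<close>

definition dx :: "(real \<times> real \<Rightarrow> real) \<Rightarrow> real \<times> real \<Rightarrow> real" where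
  "dx f = (\<lambda>(x, y). vector_derivative (\<lambda>s. f (s, y)) (at x))"

definition dy :: "(real \<times> real \<Rightarrow> real) \<Rightarrow> real \<times> real \<Rightarrow> real" where
  "dy f = (\<lambda>(x, y). vector_derivative (\<lambda>s. f (x, s)) (at y within {-1..1}))"

definition has_partials :: "(real \<times> real \<Rightarrow> real) \<Rightarrow> bool" where
  "has_partials f \<longleftrightarrow> (\<forall>x. \<forall>y\<in>{-1..1}.
     (\<lambda>s. f (s, y)) differentiable (at x) \<and>
     (\<lambda>s. f (x, s)) differentiable (at y within {-1..1}))"

definition C1_strip :: "(real \<times> real \<Rightarrow> real) \<Rightarrow> bool" where
  "C1_strip f \<longleftrightarrow> continuous_on strip f \<and> has_partials f \<and>
     continuous_on strip (dx f) \<and> continuous_on strip (dy f)"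

definition C2_strip :: "(real \<times> real \<Rightarrow> real) \<Rightarrow> bool" where
  "C2_strip f \<longleftrightarrow> C1_strip f \<and> C1_strip (dx f) \<and> C1_strip (dy f)"

definition laplacian :: "(real \<times> real \<Rightarrow> real) \<Rightarrow> real \<times> real \<Rightarrow> real" where
  "laplacian f p = dx (dx f) p + dy (dy f) p"

text \<open>
  The supremum is meaningful only for functions bounded on the strip, such as continuous
  \<open>x\<close>-periodic ones.
\<close>

definition C0_norm :: "(real \<times> real \<Rightarrow> real) \<Rightarrow> real" where
  "C0_norm f = (SUP p\<in>strip. \<bar>f p\<bar>)"

text \<open>
  Classical solutions \<open>(U, V)\<close> of the \<open>\<beta>\<close>-plane equation, with time as the first argument, for
  some pressure \<open>P\<close>. The pressure is a function on the channel at each time, hence periodic.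
  No regularity of \<open>P\<close> in time is required.
\<close>

definition beta_plane_solution ::
    "real \<Rightarrow> real \<Rightarrow> (real \<Rightarrow> real \<times> real \<Rightarrow> real) \<Rightarrow> (real \<Rightarrow> real \<times> real \<Rightarrow> real) \<Rightarrow> bool" where
  "beta_plane_solution L \<beta> U V \<longleftrightarrow> (\<exists>P :: real \<Rightarrow> real \<times> real \<Rightarrow> real.
     (\<forall>t. x_periodic L (U t) \<and> x_periodic L (V t) \<and> x_periodic L (P t) \<and>
          has_partials (U t) \<and> has_partials (V t) \<and> has_partials (P t)) \<and>
     (\<forall>t. \<forall>p\<in>strip. (\<lambda>\<tau>. U \<tau> p) differentiable (at t) \<and> (\<lambda>\<tau>. V \<tau> p) differentiable (at t)) \<and>
     (\<forall>t x. \<forall>y\<in>{-1..1}.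
        deriv (\<lambda>\<tau>. U \<tau> (x, y)) t + U t (x, y) * dx (U t) (x, y) + V t (x, y) * dy (U t) (x, y)
          - \<beta> * y * V t (x, y) = - dx (P t) (x, y) \<and>
        deriv (\<lambda>\<tau>. V \<tau> (x, y)) t + U t (x, y) * dx (V t) (x, y) + V t (x, y) * dy (V t) (x, y)
          + \<beta> * y * U t (x, y) = - dy (P t) (x, y) \<and>
        dx (U t) (x, y) + dy (V t) (x, y) = 0) \<and>
     (\<forall>t x. V t (x, -1) = 0 \<and> V t (x, 1) = 0))"

definition traveling_wave :: "real \<Rightarrow> (real \<times> real \<Rightarrow> real) \<Rightarrow> real \<Rightarrow> real \<times> real \<Rightarrow> real" where
  "traveling_wave c f t = (\<lambda>(x, y). f (x - c * t, y))"

definition shear_flow ::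
    "(real \<Rightarrow> real \<times> real \<Rightarrow> real) \<Rightarrow> (real \<Rightarrow> real \<times> real \<Rightarrow> real) \<Rightarrow> bool" where
  "shear_flow U V \<longleftrightarrow> (\<forall>t. \<forall>p\<in>strip. V t p = 0)"

definition u_cp :: "real \<Rightarrow> real \<Rightarrow> real" where
  "u_cp \<Gamma> y = \<Gamma> * y + (1 - \<Gamma>) * y\<^sup>2"

end

theory Submission imports Defs begin

text \<open>
  With \<open>U = u - c\<close> the vorticity equation reads \<open>U \<Delta>v = v (\<Delta>u - \<beta>)\<close>, and the hypothesis gives
  \<open>\<Delta>u > \<beta> \<ge> 0\<close>. Where \<open>U > 0\<close>, the maximum principle for \<open>v\<close> forces \<open>v = 0\<close>, since \<open>v\<close> vanishes
  on the walls and where \<open>U = 0\<close>. Where \<open>U < 0\<close>, it is applied to \<open>\<theta> = v / U = \<Delta>v / (\<Delta>u - \<beta>)\<close>,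
  which satisfies \<open>U \<Delta>\<theta> + 2 \<nabla>U \<cdot> \<nabla>\<theta> + \<beta> \<theta> = 0\<close> and vanishes on the walls. The second
  formula for \<open>\<theta>\<close> is continuous up to \<open>U = 0\<close>, and \<open>\<theta> = 0\<close> there: either \<open>U > 0\<close>, hence \<open>\<theta> = 0\<close>,
  at points arbitrarily close by, because \<open>U\<close> is strictly subharmonic, or the point lies on a wall
  segment with \<open>U = 0\<close>, where \<open>\<theta> U\<^sub>y = v\<^sub>y = - u\<^sub>x = 0\<close>.
\<close>

section \<open>Partial derivatives on the closed strip\<close>

text \<open>A relation with an explicit derivative lets the sum and product rules compose without
  separate existence conditions for the total operators \<open>dx\<close> and
  \<open>dy\<close>.\<close>

definition has_dx :: "(real \<times> real \<Rightarrow> real) \<Rightarrow> (real \<times> real \<Rightarrow> real) \<Rightarrow> bool" where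
  "has_dx f f' \<longleftrightarrow>
     (\<forall>x. \<forall>y\<in>{-1..1}. ((\<lambda>s. f (s, y)) has_real_derivative f' (x, y)) (at x))"

definition has_dy :: "(real \<times> real \<Rightarrow> real) \<Rightarrow> (real \<times> real \<Rightarrow> real) \<Rightarrow> bool" where
  "has_dy f f' \<longleftrightarrow>
     (\<forall>x. \<forall>y\<in>{-1..1}. ((\<lambda>s. f (x, s)) has_real_derivative f' (x, y)) (at y within {-1..1}))"

lemma mem_strip [simp]: "(x, y) \<in> strip \<longleftrightarrow> -1 \<le> y \<and> y \<le> 1"
  by (auto simp: strip_def)

lemma closed_strip: "closed strip"
  unfolding strip_def by (intro closed_Times) auto

lemma has_dxD:
  "has_dx f f' \<Longrightarrow> y \<in> {-1..1} \<Longrightarrow> ((\<lambda>s. f (s, y)) has_real_derivative f' (x, y)) (at x)"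
  by (auto simp: has_dx_def)

lemma has_dyD:
  "has_dy f f' \<Longrightarrow> y \<in> {-1..1} \<Longrightarrow>
     ((\<lambda>s. f (x, s)) has_real_derivative f' (x, y)) (at y within {-1..1})"
  by (auto simp: has_dy_def)

lemma has_partialsD:
  assumes "has_partials f"
  shows "has_dx f (dx f)" "has_dy f (dy f)"
  using assms
  by (auto simp: has_partials_def has_dx_def has_dy_def dx_def dy_def
      vector_derivative_works has_real_derivative_iff_has_vector_derivative)

lemma dx_eqI:
  assumes "has_dx f f'" "p \<in> strip"
  shows "dx f p = f' p"
  using assms
  by (cases p) (auto simp: has_dx_def dx_def has_real_derivative_iff_has_vector_derivative
      intro!: vector_derivative_at)

lemma dy_eqI:
  assumes "has_dy f f'" "p \<in> strip"
  shows "dy f p = f' p"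
  using assms
  by (cases p) (auto simp: has_dy_def dy_def has_real_derivative_iff_has_vector_derivative
      intro!: vector_derivative_within_closed_interval)

lemma has_dx_cong:
  assumes "has_dx f f'" "\<And>p. p \<in> strip \<Longrightarrow> f p = g p" "\<And>p. p \<in> strip \<Longrightarrow> f' p = g' p"
  shows "has_dx g g'"
  unfolding has_dx_def
proof (intro allI ballI)
  fix x y :: real
  assume y: "y \<in> {-1..1}"
  have "(\<lambda>s. g (s, y)) = (\<lambda>s. f (s, y))" "g' (x, y) = f' (x, y)"
    using y assms(2,3) by (auto simp: fun_eq_iff)
  then show "((\<lambda>s. g (s, y)) has_real_derivative g' (x, y)) (at x)"
    using has_dxD[OF assms(1) y] by simp
qed

lemma has_dy_cong:
  assumes "has_dy f f'" "\<And>p. p \<in> strip \<Longrightarrow> f p = g p" "\<And>p. p \<in> strip \<Longrightarrow> f' p = g' p"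
  shows "has_dy g g'"
  unfolding has_dy_def
proof (intro allI ballI)
  fix x y :: real
  assume y: "y \<in> {-1..1}"
  show "((\<lambda>s. g (x, s)) has_real_derivative g' (x, y)) (at y within {-1..1})"
    by (rule has_field_derivative_transform_within[where f = "\<lambda>s. f (x, s)" and d = 1])
      (use y has_dyD[OF assms(1) y, of x] assms(2,3) in auto)
qed

lemma has_dx_minus: "has_dx f f' \<Longrightarrow> has_dx (\<lambda>p. - f p) (\<lambda>p. - f' p)"
  by (auto simp: has_dx_def intro!: derivative_eq_intros)

lemma has_dy_minus: "has_dy f f' \<Longrightarrow> has_dy (\<lambda>p. - f p) (\<lambda>p. - f' p)"
  by (auto simp: has_dy_def intro!: derivative_eq_intros)

lemma has_dx_add: "has_dx f f' \<Longrightarrow> has_dx g g' \<Longrightarrow> has_dx (\<lambda>p. f p + g p) (\<lambda>p. f' p + g' p)"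
  by (auto simp: has_dx_def intro!: derivative_eq_intros)

lemma has_dy_add: "has_dy f f' \<Longrightarrow> has_dy g g' \<Longrightarrow> has_dy (\<lambda>p. f p + g p) (\<lambda>p. f' p + g' p)"
  by (auto simp: has_dy_def intro!: derivative_eq_intros)

lemma has_dx_mult:
  "has_dx f f' \<Longrightarrow> has_dx g g' \<Longrightarrow> has_dx (\<lambda>p. f p * g p) (\<lambda>p. f' p * g p + g' p * f p)"
  by (auto simp: has_dx_def intro!: derivative_eq_intros)

lemma has_dy_mult:
  "has_dy f f' \<Longrightarrow> has_dy g g' \<Longrightarrow> has_dy (\<lambda>p. f p * g p) (\<lambda>p. f' p * g p + g' p * f p)"
  by (auto simp: has_dy_def intro!: derivative_eq_intros)

lemma has_dx_of_y: "has_dx (\<lambda>p. g (snd p)) (\<lambda>p. 0)"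
  by (auto simp: has_dx_def)

lemma has_dy_of_y:
  "(\<And>y. (g has_real_derivative g' y) (at y)) \<Longrightarrow> has_dy (\<lambda>p. g (snd p)) (\<lambda>p. g' (snd p))"
  by (auto simp: has_dy_def intro: has_field_derivative_at_within)

text \<open>The mean value theorem, applied in both orders to the second difference of
  \<open>f\<close> over a small square near \<open>p\<close>, equates a value of \<open>fxy\<close>
  with a value of \<open>fyx\<close>. Shrinking the square and continuity give the claim, also at
  wall points.\<close>

lemma mixed_partials_eq:
  assumes fx: "has_dx f fx" and fy: "has_dy f fy"
    and fxy: "has_dy fx fxy" and fyx: "has_dx fy fyx"
    and cont: "continuous_on strip fxy" "continuous_on strip fyx"
    and p: "p \<in> strip"
  shows "fxy p = fyx p"
proof -
  obtain x y where xy: "p = (x, y)" "-1 \<le> y" "y \<le> 1"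
    using p by (cases p) auto
  have "\<bar>fxy p - fyx p\<bar> \<le> 0 + e" if "e > 0" for e
  proof -
    obtain d1 where d1: "d1 > 0" "\<And>q. q \<in> strip \<Longrightarrow> dist q p < d1 \<Longrightarrow> dist (fxy q) (fxy p) < e/2"
      using cont(1) p \<open>e > 0\<close> unfolding continuous_on_iff by (meson half_gt_zero)
    obtain d2 where d2: "d2 > 0" "\<And>q. q \<in> strip \<Longrightarrow> dist q p < d2 \<Longrightarrow> dist (fyx q) (fyx p) < e/2"
      using cont(2) p \<open>e > 0\<close> unfolding continuous_on_iff by (meson half_gt_zero)
    define h where "h = min (min d1 d2) 1 / 2"
    have h: "h > 0" "h \<le> 1/2" "h < d1" "h < d2" "2 * h \<le> d1" "2 * h \<le> d2"
      using d1 d2 by (auto simp: h_def min_def)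
    \<comment> \<open>The square extends away from the nearer wall, so it stays inside the strip
      even when \<open>p\<close> is on a wall.\<close>
    define a where "a = (if y \<le> 0 then y else y - h)"
    define b where "b = a + h"
    have ab: "a < b" "b - a = h" "-1 \<le> a" "b \<le> 1" "a \<le> y" "y \<le> b"
      using h xy by (auto simp: a_def b_def)
    have near: "dist (s, t) p < min d1 d2"
      if "x < s" "s < x + h" "a < t" "t < b" for s t
    proof -
      have "dist (s, t) p \<le> \<bar>s - x\<bar> + \<bar>t - y\<bar>"
        using sqrt_sum_squares_le_sum_abs[of "s - x" "t - y"]
        by (simp add: xy dist_Pair_Pair dist_real_def)
      also have "\<dots> < 2 * h" using that ab by auto
      finally show ?thesis using h by auto
    qed
    have sub: "{a..b} \<subseteq> {-1..1}" using ab by auto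
    have "\<exists>s. x < s \<and> s < x + h \<and>
        (f (x + h, b) - f (x + h, a)) - (f (x, b) - f (x, a)) = (x + h - x) * (fx (s, b) - fx (s, a))"
      using h ab
      by (intro MVT2) (auto intro!: derivative_eq_intros has_dxD[OF fx])
    then obtain s where s: "x < s" "s < x + h"
      "(f (x + h, b) - f (x + h, a)) - (f (x, b) - f (x, a)) = h * (fx (s, b) - fx (s, a))"
      by auto
    have "\<exists>t\<in>{a<..<b}. fx (s, b) - fx (s, a) = fxy (s, t) * (b - a)"
      using ab by (intro mvt_simple)
        (auto intro!: has_field_derivative_imp_has_derivative
          intro: has_field_derivative_subset[OF has_dyD[OF fxy] sub])
    then obtain t where t: "a < t" "t < b" "fx (s, b) - fx (s, a) = fxy (s, t) * h"
      using ab by auto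
    have "\<exists>t\<in>{a<..<b}. (f (x + h, b) - f (x, b)) - (f (x + h, a) - f (x, a))
        = (fy (x + h, t) - fy (x, t)) * (b - a)"
      using ab by (intro mvt_simple)
        (auto intro!: has_field_derivative_imp_has_derivative derivative_intros
          intro: has_field_derivative_subset[OF has_dyD[OF fy] sub])
    then obtain t' where t': "a < t'" "t' < b"
      "(f (x + h, b) - f (x, b)) - (f (x + h, a) - f (x, a)) = (fy (x + h, t') - fy (x, t')) * h"
      using ab by auto
    have "\<exists>s. x < s \<and> s < x + h \<and> fy (x + h, t') - fy (x, t') = (x + h - x) * fyx (s, t')"
      using h ab t' by (intro MVT2) (auto intro!: has_dxD[OF fyx])
    then obtain s' where s': "x < s'" "s' < x + h" "fy (x + h, t') - fy (x, t') = h * fyx (s', t')"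
      by auto
    have "h * (fxy (s, t) * h) = (h * fyx (s', t')) * h"
      using s(3) t(3) t'(3) s'(3) by (simp add: algebra_simps)
    then have eq: "fxy (s, t) = fyx (s', t')" using h by simp
    have "dist (fxy (s, t)) (fxy p) < e/2" "dist (fyx (s', t')) (fyx p) < e/2"
      using d1(2)[of "(s, t)"] d2(2)[of "(s', t')"] near[OF s(1,2) t(1,2)] near[OF s'(1,2) t'(1,2)]
        t t' ab by auto
    then show ?thesis using eq unfolding dist_real_def by linarith
  qed
  then have "\<bar>fxy p - fyx p\<bar> \<le> 0" by (rule field_le_epsilon)
  then show ?thesis by simp
qed

section \<open>Second-derivative tests on intervals and on the strip\<close>

text \<open>Since \<open>g'\<close> increases through 0 at \<open>y\<close>, the mean value theorem
  makes \<open>g\<close> grow strictly on moving away from \<open>y\<close>. Endpoints are included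
  because the lemma is applied at the walls as well as inside.\<close>

lemma greater_near_convex_critical_point:
  fixes g g' :: "real \<Rightarrow> real"
  assumes "a < b" "y \<in> {a..b}"
    and g: "\<And>z. z \<in> {a..b} \<Longrightarrow> (g has_real_derivative g' z) (at z within {a..b})"
    and "g' y = 0" and g': "(g' has_real_derivative d) (at y within {a..b})"
    and "d > 0" "e > 0"
  shows "\<exists>z\<in>{a..b}. \<bar>z - y\<bar> < e \<and> g z > g y"
proof (cases "y < b")
  case True
  obtain k where k: "k > 0" "\<And>h. h > 0 \<Longrightarrow> y + h \<in> {a..b} \<Longrightarrow> h < k \<Longrightarrow> g' y < g' (y + h)"
    using has_real_derivative_pos_inc_right[OF g' \<open>d > 0\<close>] by auto
  define z where "z = y + min (min (k/2) (e/2)) (b - y)"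
  have z: "y < z" "z \<le> b" "z < y + k" "z < y + e"
    using True k(1) \<open>e > 0\<close> by (auto simp: z_def min_def)
  have "\<exists>t\<in>{y<..<z}. g z - g y = g' t * (z - y)"
    using z assms(2)
    by (intro mvt_simple) (auto intro!: has_field_derivative_imp_has_derivative
        has_field_derivative_subset[OF g])
  then obtain t where t: "y < t" "t < z" "g z - g y = g' t * (z - y)" by auto
  have "g' t > 0" using k(2)[of "t - y"] t z assms(2,4) by auto
  then have "g z - g y > 0" unfolding t(3) using z by simp
  then show ?thesis using z assms(2) by (intro bexI[of _ z]) auto
next
  case False
  obtain k where k: "k > 0" "\<And>h. h > 0 \<Longrightarrow> y - h \<in> {a..b} \<Longrightarrow> h < k \<Longrightarrow> g' (y - h) < g' y"
    using has_real_derivative_pos_inc_left[OF g' \<open>d > 0\<close>] by auto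
  define z where "z = y - min (min (k/2) (e/2)) (y - a)"
  have z: "z < y" "a \<le> z" "y - k < z" "y - e < z"
    using False k(1) \<open>e > 0\<close> assms(1,2) by (auto simp: z_def min_def)
  have "\<exists>t\<in>{z<..<y}. g y - g z = g' t * (y - z)"
    using z assms(2)
    by (intro mvt_simple) (auto intro!: has_field_derivative_imp_has_derivative
        has_field_derivative_subset[OF g])
  then obtain t where t: "z < t" "t < y" "g y - g z = g' t * (y - z)" by auto
  have "g' t < 0" using k(2)[of "y - t"] t z assms(2,4) by auto
  then have "g y - g z < 0" unfolding t(3) using z by (simp add: mult_neg_pos)
  then show ?thesis using z assms(2) by (intro bexI[of _ z]) auto
qed

text \<open>At an interior local maximum \<open>g' x = 0\<close>, so \<open>d > 0\<close> would make
  \<open>x\<close> a convex critical point with larger values nearby.\<close>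

lemma second_derivative_nonpos_at_max:
  fixes g g' :: "real \<Rightarrow> real"
  assumes "a < x" "x < b"
    and g: "\<And>z. z \<in> {a..b} \<Longrightarrow> (g has_real_derivative g' z) (at z within {a..b})"
    and g': "(g' has_real_derivative d) (at x within {a..b})"
    and "e > 0" and max: "\<And>z. z \<in> {a..b} \<Longrightarrow> \<bar>z - x\<bar> < e \<Longrightarrow> g z \<le> g x"
  shows "d \<le> 0"
proof (rule ccontr)
  assume "\<not> d \<le> 0"
  have "at x within {a..b} = at x"
    using assms(1,2) by (intro at_within_Icc_at) auto
  then have "(g has_real_derivative g' x) (at x)"
    using g[of x] assms(1,2) by auto
  moreover have "0 < min e (min (x - a) (b - x))"
    using assms by auto
  moreover have "\<forall>z. \<bar>x - z\<bar> < min e (min (x - a) (b - x)) \<longrightarrow> g z \<le> g x"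
    by (intro allI impI max) auto
  ultimately have "g' x = 0" by (rule DERIV_local_max)
  then show False
    using greater_near_convex_critical_point[of a b x g g' d e] assms \<open>\<not> d \<le> 0\<close> by force
qed

text \<open>The one-variable test is applied along the two coordinate lines through the
  point.\<close>

lemma laplacian_nonpos_at_max:
  assumes f: "has_dx f f1" "has_dx f1 f11" "has_dy f f2" "has_dy f2 f22"
    and y: "-1 < y" "y < 1" and "e > 0"
    and max: "\<And>q. q \<in> strip \<Longrightarrow> dist q (x, y) < e \<Longrightarrow> f q \<le> f (x, y)"
  shows "f11 (x, y) + f22 (x, y) \<le> 0"
proof -
  have "f11 (x, y) \<le> 0"
    by (rule second_derivative_nonpos_at_max[of "x - 1" x "x + 1" "\<lambda>s. f (s, y)" "\<lambda>s. f1 (s, y)" _ e])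
      (use y \<open>e > 0\<close> in \<open>auto intro!: max has_field_derivative_at_within has_dxD[OF f(1)] has_dxD[OF f(2)]
        simp: dist_Pair_Pair dist_real_def\<close>)
  moreover have "f22 (x, y) \<le> 0"
    by (rule second_derivative_nonpos_at_max[of "-1" y 1 "\<lambda>s. f (x, s)" "\<lambda>s. f2 (x, s)" _ e])
      (use y \<open>e > 0\<close> in \<open>auto intro!: max has_dyD[OF f(3)] has_dyD[OF f(4)]
        simp: dist_Pair_Pair dist_real_def\<close>)
  ultimately show ?thesis by simp
qed

section \<open>Periodic functions\<close>

lemma x_periodic_shift:
  assumes "x_periodic L f" "y \<in> {-1..1}"
  shows "f (x + of_int k * L, y) = f (x, y)"
proof -
  have nat: "f (x + of_nat n * L, y) = f (x, y)" for x n
  proof (induction n)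
    case (Suc n)
    have "f (x + of_nat (Suc n) * L, y) = f ((x + of_nat n * L) + L, y)"
      by (simp add: algebra_simps)
    also have "\<dots> = f (x + of_nat n * L, y)"
      using assms unfolding x_periodic_def by blast
    finally show ?case using Suc by simp
  qed simp
  show ?thesis
  proof (cases "k \<ge> 0")
    case True
    then show ?thesis using nat[of x "nat k"] by simp
  next
    case False
    then show ?thesis using nat[of "x + of_int k * L" "nat (- k)"] by simp
  qed
qed

text \<open>\<open>g\<close> encodes the region of maximization: a sign condition on
  \<open>U\<close>, or the whole strip for \<open>g = 0\<close>. The part of the region over one
  period is compact, and \<open>f\<close> already takes all its values there.\<close>

lemma x_periodic_attains_max:
  assumes L: "L > 0" and per: "x_periodic L f" "x_periodic L g"
    and cont: "continuous_on strip f" "continuous_on strip g"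
    and ne: "p0 \<in> strip" "g p0 \<ge> 0"
  obtains p where "p \<in> strip" "g p \<ge> 0" "\<And>q. q \<in> strip \<Longrightarrow> g q \<ge> 0 \<Longrightarrow> f q \<le> f p"
proof -
  define R where "R = {0..L} \<times> {-1..1::real}"
  define C where "C = R \<inter> {q \<in> strip. 0 \<le> g q}"
  have red: "\<exists>q'\<in>R. q' \<in> strip \<and> f q' = f q \<and> g q' = g q" if "q \<in> strip" for q
  proof -
    obtain x y where q: "q = (x, y)" "y \<in> {-1..1}"
      using \<open>q \<in> strip\<close> by (metis atLeastAtMost_iff mem_strip surj_pair)
    define k where "k = \<lfloor>x / L\<rfloor>"
    have "of_int k \<le> x / L" "x / L \<le> of_int k + 1" by (auto simp: k_def)
    then have "of_int k * L \<le> x" "x \<le> of_int k * L + L"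
      using L by (auto simp: field_simps)
    moreover have "f (x + of_int (-k) * L, y) = f (x, y)" "g (x + of_int (-k) * L, y) = g (x, y)"
      using x_periodic_shift[OF per(1) q(2), of x "-k"] x_periodic_shift[OF per(2) q(2), of x "-k"]
      by auto
    ultimately show ?thesis
      using q by (intro bexI[of _ "(x + of_int (-k) * L, y)"]) (auto simp: R_def)
  qed
  have "compact C"
    unfolding C_def R_def using cont closed_strip
    by (intro compact_Int_closed compact_Times continuous_on_closed_Collect_le) auto
  moreover have "C \<noteq> {}" using red[OF ne(1)] ne(2) by (force simp: C_def)
  moreover have "continuous_on C f"
    by (rule continuous_on_subset[OF cont(1)]) (auto simp: C_def)
  ultimately obtain p where p: "p \<in> C" "\<And>q. q \<in> C \<Longrightarrow> f q \<le> f p"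
    using continuous_attains_sup[of C f] by blast
  show ?thesis
  proof (rule that[of p])
    fix q assume "q \<in> strip" "g q \<ge> 0"
    then show "f q \<le> f p" using red[of q] p(2) by (fastforce simp: C_def)
  qed (use p in \<open>auto simp: C_def\<close>)
qed

lemma x_periodic_abs_bound:
  assumes "L > 0" "x_periodic L f" "continuous_on strip f"
  obtains B where "B \<ge> 0" "\<And>q. q \<in> strip \<Longrightarrow> \<bar>f q\<bar> \<le> B"
proof -
  obtain p where "p \<in> strip" "\<And>q. q \<in> strip \<Longrightarrow> \<bar>f q\<bar> \<le> \<bar>f p\<bar>"
    by (rule x_periodic_attains_max[of L "\<lambda>q. \<bar>f q\<bar>" "\<lambda>q. 0" "(0, 0)"])
      (use assms in \<open>auto simp: x_periodic_def intro!: continuous_intros\<close>)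
  then show ?thesis using that[of "\<bar>f p\<bar>"] by auto
qed

lemma x_periodic_dx:
  assumes "x_periodic L f" "has_partials f"
  shows "x_periodic L (dx f)"
  unfolding x_periodic_def
proof (intro allI ballI)
  fix x y :: real assume y: "y \<in> {-1..1}"
  have "((\<lambda>s. f (s, y)) has_real_derivative dx f (x + L, y)) (at (x + L))"
    by (rule has_dxD[OF has_partialsD(1)[OF assms(2)] y])
  then have "((\<lambda>s. f (s + L, y)) has_real_derivative dx f (x + L, y)) (at x)"
    by (simp add: DERIV_shift)
  moreover have "(\<lambda>s. f (s + L, y)) = (\<lambda>s. f (s, y))"
    using assms(1) y by (auto simp: x_periodic_def)
  ultimately show "dx f (x + L, y) = dx f (x, y)"
    using has_dxD[OF has_partialsD(1)[OF assms(2)] y] DERIV_unique by metis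
qed

lemma x_periodic_dy:
  assumes "x_periodic L f" "has_partials f"
  shows "x_periodic L (dy f)"
  unfolding x_periodic_def
proof (intro allI ballI)
  fix x y :: real assume y: "y \<in> {-1..1}"
  have "has_dy (\<lambda>(x, y). f (x + L, y)) (\<lambda>(x, y). dy f (x + L, y))"
    using has_dyD[OF has_partialsD(2)[OF assms(2)]] by (auto simp: has_dy_def)
  then have "has_dy f (\<lambda>(x, y). dy f (x + L, y))"
    by (rule has_dy_cong) (use assms(1) in \<open>auto simp: x_periodic_def\<close>)
  from dy_eqI[OF this, of "(x, y)"] y show "dy f (x + L, y) = dy f (x, y)" by simp
qed

section \<open>Maximum principles for the Rayleigh equation\<close>

text \<open>
  \<open>U\<close> is the relative velocity \<open>u - c\<close>. The quotient \<open>\<theta> = v / U\<close> is the slope of the level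
  curves of the absolute vorticity and extends continuously across \<open>U = 0\<close>.
\<close>

locale rayleigh_strip =
  fixes L \<beta> :: real
    and U Ux Uy Uxx Uyy v vx vy vxx vyy \<theta> :: "real \<times> real \<Rightarrow> real"
  assumes L_pos: "L > 0" and beta_nonneg: "\<beta> \<ge> 0"
    and U_partials: "has_dx U Ux" "has_dx Ux Uxx" "has_dy U Uy" "has_dy Uy Uyy"
    and v_partials: "has_dx v vx" "has_dx vx vxx" "has_dy v vy" "has_dy vy vyy"
    and periodic: "x_periodic L U" "x_periodic L Uy" "x_periodic L \<theta>"
    and cont: "continuous_on strip U" "continuous_on strip Uy" "continuous_on strip \<theta>"
    and laplacian_U: "p \<in> strip \<Longrightarrow> \<beta> < Uxx p + Uyy p"
    and laplacian_v: "p \<in> strip \<Longrightarrow> vxx p + vyy p = \<theta> p * (Uxx p + Uyy p - \<beta>)"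
    and v_eq: "p \<in> strip \<Longrightarrow> v p = U p * \<theta> p"
    and wall: "v (x, -1) = 0" "v (x, 1) = 0"
begin

text \<open>The hypotheses are linear and homogeneous in the pair \<open>v\<close>, theta, so each
  one-sided bound below also applies to the negated pair and becomes an equality.\<close>

lemma uminus_v:
  "rayleigh_strip L \<beta> U Ux Uy Uxx Uyy (\<lambda>p. - v p) (\<lambda>p. - vx p) (\<lambda>p. - vy p)
     (\<lambda>p. - vxx p) (\<lambda>p. - vyy p) (\<lambda>p. - \<theta> p)"
proof
  fix p assume "p \<in> strip"
  then show "- vxx p + - vyy p = - \<theta> p * (Uxx p + Uyy p - \<beta>)"
    using laplacian_v[of p] by simp
qed (use L_pos beta_nonneg U_partials v_partials periodic cont laplacian_U v_eq wall
  in \<open>auto intro!: has_dx_minus has_dy_minus continuous_intros simp: x_periodic_def\<close>)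

text \<open>At a positive maximum of \<open>v\<close> over the region, \<open>v = U \<theta>\<close>
  forces \<open>U > 0\<close> and theta positive, so the point is a local maximum in the strip and
  off the walls. But there the Laplacian of \<open>v\<close> is theta times a positive
  factor.\<close>

lemma v_nonpos_where_U_nonneg:
  assumes "p \<in> strip" "U p \<ge> 0"
  shows "v p \<le> 0"
proof -
  obtain m where m: "m \<in> strip" "U m \<ge> 0"
    and max: "\<And>q. q \<in> strip \<Longrightarrow> U q \<ge> 0 \<Longrightarrow> v q \<le> v m"
  \<comment> \<open>The locale provides continuity and periodicity for \<open>U\<close> and theta,
    so \<open>v\<close> is maximized in the form \<open>U q * \<theta> q\<close>.\<close>
  proof (rule x_periodic_attains_max[of L "\<lambda>q. U q * \<theta> q" U p])
    show "x_periodic L (\<lambda>q. U q * \<theta> q)"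
      using periodic by (auto simp: x_periodic_def)
    show "continuous_on strip (\<lambda>q. U q * \<theta> q)"
      using cont by (intro continuous_intros)
  qed (use assms L_pos periodic cont v_eq in auto)
  have "v m \<le> 0"
  proof (rule ccontr)
    assume pos: "\<not> v m \<le> 0"
    obtain x y where xy: "m = (x, y)" by (cases m)
    have "U m > 0" using pos v_eq[OF m(1)] m(2) by (cases "U m = 0") auto
    then obtain d where d: "d > 0" "\<And>q. q \<in> strip \<Longrightarrow> dist q m < d \<Longrightarrow> dist (U q) (U m) < U m"
      using cont(1) m(1) unfolding continuous_on_iff by blast
    have near: "v q \<le> v m" if "q \<in> strip" "dist q m < d" for q
      using d(2)[OF that] max[OF that(1)] by (auto simp: dist_real_def)
    have "y \<noteq> -1" "y \<noteq> 1" using pos wall xy by auto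
    then have y: "-1 < y" "y < 1" using m(1) xy by auto
    have "vxx m + vyy m \<le> 0"
      using laplacian_nonpos_at_max[OF v_partials y d(1)] near xy by blast
    moreover have "\<theta> m > 0"
      using pos v_eq[OF m(1)] \<open>U m > 0\<close> by (simp add: zero_less_mult_iff not_le)
    then have "vxx m + vyy m > 0"
      using laplacian_v[OF m(1)] laplacian_U[OF m(1)] by simp
    ultimately show False by simp
  qed
  with max[OF assms] show ?thesis by simp
qed

lemma v_zero_where_U_nonneg:
  assumes "p \<in> strip" "U p \<ge> 0"
  shows "v p = 0"
  using v_nonpos_where_U_nonneg[OF assms]
    rayleigh_strip.v_nonpos_where_U_nonneg[OF uminus_v assms] by simp

text \<open>If theta is nonzero at \<open>m\<close>, it is nonzero nearby, and there
  \<open>U > 0\<close> would contradict \<open>v = 0\<close>. Hence \<open>U\<close> has a local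
  maximum 0 at \<open>m\<close>, which its positive Laplacian excludes; at a wall this needs the
  vanishing of \<open>Uxx\<close> and \<open>Uy\<close> first.\<close>

lemma theta_zero_where_U_zero:
  assumes div: "\<And>p. p \<in> strip \<Longrightarrow> Ux p + vy p = 0"
    and m: "m \<in> strip" "U m = 0"
  shows "\<theta> m = 0"
proof (rule ccontr)
  assume nz: "\<theta> m \<noteq> 0"
  obtain x y where xy: "m = (x, y)" and y: "y \<in> {-1..1}"
    using m(1) by (metis atLeastAtMost_iff mem_strip surj_pair)
  obtain d where d: "d > 0" "\<And>q. q \<in> strip \<Longrightarrow> dist q m < d \<Longrightarrow> dist (\<theta> q) (\<theta> m) < \<bar>\<theta> m\<bar>"
    using cont(3) m(1) nz unfolding continuous_on_iff by (metis zero_less_abs_iff)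
  have theta_nz: "\<theta> q \<noteq> 0" if "q \<in> strip" "dist q m < d" for q
    using d(2)[OF that] by (auto simp: dist_real_def)
  have U_le: "U q \<le> 0" if "q \<in> strip" "dist q m < d" for q
    using v_zero_where_U_nonneg[of q] v_eq[of q] theta_nz[OF that] that(1) by force
  show False
  proof (cases "y = -1 \<or> y = 1")
    case False
    then have "-1 < y" "y < 1" using y by auto
    from laplacian_nonpos_at_max[OF U_partials this d(1), of x] have "Uxx m + Uyy m \<le> 0"
      using U_le m(2) xy by auto
    then show False using laplacian_U[OF m(1)] beta_nonneg by simp
  next
    case True
    \<comment> \<open>On the wall \<open>v = U \<theta> = 0\<close> while theta is nonzero, so
      \<open>U\<close> vanishes on a whole wall segment around \<open>m\<close>.\<close>
    have U0: "U (s, y) = 0" if "\<bar>s - x\<bar> < d" for s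
      using v_eq[of "(s, y)"] theta_nz[of "(s, y)"] that y True wall[of s] xy
      by (auto simp: dist_Pair_Pair dist_real_def)
    have Ux0: "Ux (s, y) = 0" if "\<bar>s - x\<bar> < d" for s
    proof -
      have "((\<lambda>s. U (s, y)) has_real_derivative 0) (at s)"
      proof (rule has_field_derivative_transform_within[where f = "\<lambda>s. 0" and d = "d - \<bar>s - x\<bar>"])
        fix t assume "dist t s < d - \<bar>s - x\<bar>"
        then show "0 = U (t, y)" using U0[of t] by (auto simp: dist_real_def)
      qed (use that in auto)
      with has_dxD[OF U_partials(1) y] show ?thesis by (rule DERIV_unique)
    qed
    have "((\<lambda>s. Ux (s, y)) has_real_derivative 0) (at x)"
      by (rule has_field_derivative_transform_within[where f = "\<lambda>s. 0" and d = d])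
        (use d(1) Ux0 in \<open>auto simp: dist_real_def\<close>)
    with has_dxD[OF U_partials(2) y] have Uxx0: "Uxx m = 0"
      unfolding xy by (rule DERIV_unique)
    have vy0: "vy m = 0" using div[OF m(1)] Ux0[of x] d(1) xy by simp
    \<comment> \<open>As \<open>U\<close> and \<open>v\<close> vanish at \<open>m\<close>, the
      difference quotient of \<open>v\<close> is that of \<open>U\<close> times theta. Its limit is
      \<open>Uy m * \<theta> m\<close>, obtained from continuity of theta alone.\<close>
    have limv: "((\<lambda>t. (v (x, t) - v (x, y)) / (t - y)) \<longlongrightarrow> vy m) (at y within {-1..1})"
      using has_dyD[OF v_partials(3) y] by (simp add: has_field_derivative_iff xy)
    have limU: "((\<lambda>t. (U (x, t) - U (x, y)) / (t - y)) \<longlongrightarrow> Uy m) (at y within {-1..1})"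
      using has_dyD[OF U_partials(3) y] by (simp add: has_field_derivative_iff xy)
    have "continuous_on {-1..1} (\<lambda>t. \<theta> (x, t))"
      by (rule continuous_on_compose2[OF cont(3)]) (auto intro!: continuous_intros)
    then have "((\<lambda>t. \<theta> (x, t)) \<longlongrightarrow> \<theta> m) (at y within {-1..1})"
      using y xy by (auto simp: continuous_on)
    from tendsto_mult[OF limU this]
    have "((\<lambda>t. (v (x, t) - v (x, y)) / (t - y)) \<longlongrightarrow> Uy m * \<theta> m) (at y within {-1..1})"
      by (rule Lim_transform_within[of _ _ _ _ 1])
        (use v_eq m xy y in \<open>auto simp: divide_simps\<close>)
    moreover have "at y within {-1..1} \<noteq> bot"
      using y islimpt_Icc[of "-1" 1 y] by (simp add: trivial_limit_within)
    ultimately have "Uy m * \<theta> m = vy m" using limv tendsto_unique by blast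
    then have "Uy (x, y) = 0" using vy0 nz xy by simp
    moreover have "Uyy (x, y) > 0"
      using laplacian_U[OF m(1)] beta_nonneg Uxx0 xy by simp
    \<comment> \<open>With \<open>Uy = 0\<close> and \<open>Uyy > 0\<close> at the wall,
      \<open>U\<close> becomes positive just inside, against \<open>U_le\<close>.\<close>
    ultimately obtain z where z: "z \<in> {-1..1}" "\<bar>z - y\<bar> < d" "U (x, z) > U (x, y)"
      using greater_near_convex_critical_point[of "-1" 1 y "\<lambda>t. U (x, t)" "\<lambda>t. Uy (x, t)"
          "Uyy (x, y)" d] y d(1) has_dyD[OF U_partials(3)] has_dyD[OF U_partials(4)]
      by auto
    with U_le[of "(x, z)"] m(2) xy show False
      by (auto simp: dist_Pair_Pair dist_real_def)
  qed
qed

text \<open>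
  Where \<open>U < 0\<close>, the equation reads \<open>U \<Delta>\<theta> + 2 \<nabla>U \<cdot> \<nabla>\<theta> = - \<beta> \<theta>\<close>, which satisfies a maximum
  principle without any sign of \<open>\<Delta>U\<close>. The perturbation \<open>\<epsilon> exp (\<lambda> y)\<close> makes the inequality strict
  (needed for \<open>\<beta> = 0\<close>). As \<open>\<theta>\<close> need not be differentiable at \<open>U = 0\<close>, the second-derivative test is
  applied to \<open>U (M - \<epsilon> exp (\<lambda> y)) - v\<close> instead of \<open>\<theta> + \<epsilon> exp (\<lambda> y)\<close>.
\<close>

lemma theta_nonpos_where_U_nonpos:
  assumes zero: "\<And>q. q \<in> strip \<Longrightarrow> U q = 0 \<Longrightarrow> \<theta> q = 0"
    and p: "p \<in> strip" "U p \<le> 0"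
  shows "\<theta> p \<le> 0"
proof (rule ccontr)
  assume "\<not> \<theta> p \<le> 0"
  define m where "m = \<theta> p"
  have m: "m > 0" using \<open>\<not> \<theta> p \<le> 0\<close> by (simp add: m_def)
  \<comment> \<open>\<open>G q \<ge> 0\<close> packs \<open>U q \<le> 0\<close> and
    \<open>\<theta> q \<ge> m / 2\<close> into one continuous periodic constraint. By
    \<open>zero\<close>, \<open>U\<close> does not vanish on this set, so its maximum there is some
    \<open>- s < 0\<close>.\<close>
  define G where "G q = min (- U q) (\<theta> q - m / 2)" for q
  have G: "x_periodic L G" "continuous_on strip G" "G p \<ge> 0"
    unfolding G_def[abs_def] using periodic cont p m
    by (auto simp: x_periodic_def m_def intro!: continuous_intros)
  obtain r where r: "r \<in> strip" "G r \<ge> 0" "\<And>q. q \<in> strip \<Longrightarrow> G q \<ge> 0 \<Longrightarrow> U q \<le> U r"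
    using x_periodic_attains_max[OF L_pos periodic(1) G(1) cont(1) G(2) p(1) G(3)] by blast
  define s where "s = - U r"
  have "U r \<noteq> 0" using zero[OF r(1)] r(2) m by (auto simp: G_def)
  then have s: "s > 0" using r(2) by (auto simp: s_def G_def)
  obtain B where B: "B \<ge> 0" "\<And>q. q \<in> strip \<Longrightarrow> \<bar>Uy q\<bar> \<le> B"
    using x_periodic_abs_bound[OF L_pos periodic(2) cont(2)] by blast
  \<comment> \<open>\<open>k\<close> and \<open>e\<close> are the lambda and epsilon of the
    perturbation. This \<open>k\<close> makes \<open>- k * U\<close> exceed
    \<open>2 * \<bar>Uy\<bar>\<close> wherever \<open>U \<le> - s\<close>.\<close>
  define k where "k = (2 * B + 1) / s"
  have k: "k > 0" "s * k = 2 * B + 1" using s B(1) by (auto simp: k_def)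
  \<comment> \<open>This size keeps the perturbation \<open>g\<close> at most \<open>m / 4\<close>
    on the strip, so a maximum point of theta plus \<open>g\<close> still has theta above
    \<open>m / 2\<close>.\<close>
  define e where "e = m / (4 * exp k)"
  have e: "e > 0" "e * exp k = m / 4" using m by (auto simp: e_def)
  define g where "g y = e * exp (k * y)" for y
  have g_pos: "g y > 0" for y using e by (simp add: g_def)
  have g_le: "g y \<le> m / 4" if "y \<le> 1" for y
  proof -
    have "exp (k * y) \<le> exp k" using that k(1) by simp
    then show ?thesis using e by (metis g_def mult_left_mono less_imp_le)
  qed
  obtain a where a: "a \<in> strip" "- U a \<ge> 0"
    "\<And>q. q \<in> strip \<Longrightarrow> - U q \<ge> 0 \<Longrightarrow> \<theta> q + g (snd q) \<le> \<theta> a + g (snd a)"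
  proof (rule x_periodic_attains_max[of L "\<lambda>q. \<theta> q + g (snd q)" "\<lambda>q. - U q" p])
    show "continuous_on strip (\<lambda>q. \<theta> q + g (snd q))"
      unfolding g_def using cont by (intro continuous_intros)
  qed (use L_pos periodic cont p in \<open>auto simp: x_periodic_def intro!: continuous_intros\<close>)
  obtain x y where xy: "a = (x, y)" and y: "y \<in> {-1..1}"
    using a(1) by (metis atLeastAtMost_iff mem_strip surj_pair)
  define M where "M = \<theta> a + g y"
  have "m < M" using a(3)[OF p(1)] p(2) g_pos[of "snd p"] by (simp add: M_def m_def xy)
  then have theta_a: "\<theta> a > m / 2" using g_le[of y] y m by (simp add: M_def)
  have Ua: "U a \<le> - s" using r(3)[OF a(1)] a(2) theta_a by (auto simp: G_def s_def)
  have "v a \<noteq> 0" using v_eq[OF a(1)] theta_a m Ua s by simp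
  then have "y \<noteq> -1" "y \<noteq> 1" using wall xy by auto
  then have y': "-1 < y" "y < 1" using y by auto
  \<comment> \<open>\<open>h\<close> equals \<open>U (M - g - \<theta>)\<close>. Near
    \<open>a\<close> the first factor is negative and the second is nonnegative, so \<open>h\<close>
    has a local maximum 0 at \<open>a\<close>.\<close>
  define h where "h = (\<lambda>q. U q * (M - g (snd q)) + - v q)"
  have h_a: "h a = 0" using v_eq[OF a(1)] by (simp add: h_def M_def xy)
  obtain d where d: "d > 0" "\<And>q. q \<in> strip \<Longrightarrow> dist q a < d \<Longrightarrow> dist (U q) (U a) < s"
    using cont(1) a(1) s unfolding continuous_on_iff by blast
  have h_le: "h q \<le> h a" if "q \<in> strip" "dist q a < d" for q
  proof -
    have "U q < 0" using d(2)[OF that] Ua by (auto simp: dist_real_def)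
    moreover have "\<theta> q + g (snd q) \<le> M"
      using a(3)[OF that(1)] \<open>U q < 0\<close> by (simp add: M_def xy)
    ultimately have "U q * (M - g (snd q) - \<theta> q) \<le> 0"
      by (intro mult_nonpos_nonneg) auto
    then show ?thesis unfolding h_a by (simp add: h_def v_eq[OF that(1)] algebra_simps)
  qed
  have g1: "((\<lambda>y. M - g y) has_real_derivative - k * g y) (at y)" for y
    unfolding g_def by (auto intro!: derivative_eq_intros)
  have g2: "((\<lambda>y. - k * g y) has_real_derivative - (k\<^sup>2) * g y) (at y)" for y
    unfolding g_def by (auto intro!: derivative_eq_intros simp: power2_eq_square)
  have "has_dx h (\<lambda>q. (Ux q * (M - g (snd q)) + 0 * U q) + - vx q)"
    unfolding h_def
    by (intro has_dx_add has_dx_mult has_dx_minus U_partials v_partials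
        has_dx_of_y[of "\<lambda>t. M - g t"])
  then have hx: "has_dx h (\<lambda>q. Ux q * (M - g (snd q)) + - vx q)" by simp
  have "has_dx (\<lambda>q. Ux q * (M - g (snd q)) + - vx q)
      (\<lambda>q. (Uxx q * (M - g (snd q)) + 0 * Ux q) + - vxx q)"
    by (intro has_dx_add has_dx_mult has_dx_minus U_partials v_partials
        has_dx_of_y[of "\<lambda>t. M - g t"])
  then have hxx: "has_dx (\<lambda>q. Ux q * (M - g (snd q)) + - vx q)
      (\<lambda>q. Uxx q * (M - g (snd q)) + - vxx q)" by simp
  have hy: "has_dy h (\<lambda>q. (Uy q * (M - g (snd q)) + (- k * g (snd q)) * U q) + - vy q)"
    unfolding h_def
    by (intro has_dy_add has_dy_mult has_dy_minus U_partials v_partials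
        has_dy_of_y[of "\<lambda>t. M - g t"] g1)
  have hyy: "has_dy (\<lambda>q. (Uy q * (M - g (snd q)) + (- k * g (snd q)) * U q) + - vy q)
      (\<lambda>q. ((Uyy q * (M - g (snd q)) + (- k * g (snd q)) * Uy q) +
        ((- (k\<^sup>2) * g (snd q)) * U q + Uy q * (- k * g (snd q)))) + - vyy q)"
    by (intro has_dy_add has_dy_mult has_dy_minus U_partials v_partials
        has_dy_of_y[of "\<lambda>t. M - g t"] has_dy_of_y[of "\<lambda>t. - k * g t"] g1 g2)
  have "(Uxx a * (M - g y) - vxx a) +
    (Uyy a * (M - g y) - 2 * k * g y * Uy a - (k\<^sup>2) * g y * U a - vyy a) \<le> 0"
    using laplacian_nonpos_at_max[OF hx hxx hy hyy y' d(1), of x] h_le xy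
    by (simp add: algebra_simps)
  \<comment> \<open>At \<open>a\<close> the Laplacian of \<open>v\<close> is
    \<open>\<theta> a\<close> times that of \<open>U\<close> minus \<open>\<beta>\<close>, so the
    Laplacians of \<open>U\<close> cancel and only \<open>\<beta>\<close> and the derivatives of
    \<open>g\<close> remain.\<close>
  moreover have "M - g y = \<theta> a" by (simp add: M_def)
  ultimately have "\<theta> a * \<beta> + k * g y * (- 2 * Uy a - k * U a) \<le> 0"
    using laplacian_v[OF a(1)] by (simp add: algebra_simps power2_eq_square)
  moreover have "\<theta> a * \<beta> \<ge> 0" using theta_a m beta_nonneg by simp
  moreover have "- 2 * Uy a - k * U a > 0"
  proof -
    have "k * U a \<le> k * (- s)" using Ua k(1) by (intro mult_left_mono) auto
    then show ?thesis using B(2)[OF a(1)] k(2) by (simp add: mult.commute abs_le_iff)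
  qed
  then have "k * g y * (- 2 * Uy a - k * U a) > 0" using k(1) g_pos by simp
  ultimately show False by simp
qed

lemma v_vanishes:
  assumes div: "\<And>p. p \<in> strip \<Longrightarrow> Ux p + vy p = 0" and p: "p \<in> strip"
  shows "v p = 0"
proof (cases "U p \<ge> 0")
  case True
  then show ?thesis using v_zero_where_U_nonneg p by simp
next
  case False
  have zero: "\<theta> q = 0" if "q \<in> strip" "U q = 0" for q
    using theta_zero_where_U_zero[OF div that] by simp
  have "\<theta> p \<le> 0" "- \<theta> p \<le> 0"
    using theta_nonpos_where_U_nonpos[OF zero p]
      rayleigh_strip.theta_nonpos_where_U_nonpos[OF uminus_v _ p] zero False by auto
  then show ?thesis using v_eq[OF p] by simp
qed

end

section \<open>Traveling waves\<close>

lemma C1_stripD: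
  assumes "C1_strip f"
  shows "has_dx f (dx f)" "has_dy f (dy f)"
    "continuous_on strip f" "continuous_on strip (dx f)" "continuous_on strip (dy f)"
  using assms has_partialsD by (auto simp: C1_strip_def)

lemma C2_stripD:
  assumes "C2_strip f"
  shows "C1_strip f" "C1_strip (dx f)" "C1_strip (dy f)"
  using assms by (auto simp: C2_strip_def)

text \<open>At time 0 the wave coincides with its profile, so evaluating the equation at that one
  time yields the steady equation with relative velocity \<open>u - c\<close>.\<close>

lemma deriv_traveling_wave:
  assumes "has_dx f (dx f)" "y \<in> {-1..1}"
  shows "deriv (\<lambda>\<tau>. traveling_wave c f \<tau> (x, y)) 0 = - c * dx f (x, y)"
proof -
  have "((\<lambda>s. f (s, y)) has_real_derivative dx f (x, y)) (at (x - c * 0))"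
    using has_dxD[OF assms] by simp
  then have "((\<lambda>\<tau>. f (x - c * \<tau>, y)) has_real_derivative dx f (x, y) * (- c)) (at 0)"
    by (rule DERIV_chain2) (auto intro!: derivative_eq_intros)
  then show ?thesis by (simp add: traveling_wave_def DERIV_imp_deriv)
qed

text \<open>Equality of the mixed partial derivatives of the pressure is the vorticity equation.\<close>

lemma traveling_wave_rayleigh:
  assumes C2: "C2_strip u" "C2_strip v"
    and sol: "beta_plane_solution L \<beta> (traveling_wave c u) (traveling_wave c v)"
  shows "v (x, -1) = 0" "v (x, 1) = 0"
    and "p \<in> strip \<Longrightarrow> dx u p + dy v p = 0"
    and "p \<in> strip \<Longrightarrow> (u p - c) * laplacian v p = v p * (laplacian u p - \<beta>)"
proof -
  note u = C1_stripD[OF C2_stripD(1)[OF C2(1)]] C1_stripD[OF C2_stripD(2)[OF C2(1)]]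
    C1_stripD[OF C2_stripD(3)[OF C2(1)]]
  note v = C1_stripD[OF C2_stripD(1)[OF C2(2)]] C1_stripD[OF C2_stripD(2)[OF C2(2)]]
    C1_stripD[OF C2_stripD(3)[OF C2(2)]]
  have tw0: "traveling_wave c f 0 = f" for f
    by (simp add: traveling_wave_def)
  obtain P :: "real \<times> real \<Rightarrow> real" where P: "has_partials P"
    and mom: "\<And>x y. y \<in> {-1..1} \<Longrightarrow>
        - c * dx u (x, y) + u (x, y) * dx u (x, y) + v (x, y) * dy u (x, y) - \<beta> * y * v (x, y)
          = - dx P (x, y) \<and>
        - c * dx v (x, y) + u (x, y) * dx v (x, y) + v (x, y) * dy v (x, y) + \<beta> * y * u (x, y)
          = - dy P (x, y) \<and>
        dx u (x, y) + dy v (x, y) = 0"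
    and wall: "\<And>x. v (x, -1) = 0 \<and> v (x, 1) = 0"
    using sol unfolding beta_plane_solution_def
  proof (elim exE conjE, goal_cases)
    case (1 Q)
    show ?thesis
    proof (rule 1(1)[of "Q 0"])
      show "has_partials (Q 0)" using 1(2) by blast
      show "v (x, -1) = 0 \<and> v (x, 1) = 0" for x
        using 1(5)[rule_format, of 0 x] by (simp add: tw0)
      show "- c * dx u (x, y) + u (x, y) * dx u (x, y) + v (x, y) * dy u (x, y) - \<beta> * y * v (x, y)
          = - dx (Q 0) (x, y) \<and>
        - c * dx v (x, y) + u (x, y) * dx v (x, y) + v (x, y) * dy v (x, y) + \<beta> * y * u (x, y)
          = - dy (Q 0) (x, y) \<and>
        dx u (x, y) + dy v (x, y) = 0" if y: "y \<in> {-1..1}" for x y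
        using 1(4)[rule_format, OF y, where t = 0 and x = x]
        unfolding deriv_traveling_wave[OF u(1) y] deriv_traveling_wave[OF v(1) y] tw0 .
    qed
  qed
  show "v (x, -1) = 0" "v (x, 1) = 0" using wall by auto
  have div: "dx u p + dy v p = 0" if "p \<in> strip" for p
    using that mom[of "snd p" "fst p"] by (cases p) auto
  then show "p \<in> strip \<Longrightarrow> dx u p + dy v p = 0" .
  assume p: "p \<in> strip"
  define w where "w = (\<lambda>p. u p - c)"
  have w: "has_dx w (dx u)" "has_dy w (dy u)" "continuous_on strip w"
    using u(1-3) by (auto simp: w_def has_dx_def has_dy_def 
        intro!: derivative_eq_intros continuous_intros)
  \<comment> \<open>\<open>F\<close> and \<open>G\<close> are the components of the pressure
    gradient read off the momentum equations. \<open>Fy\<close> and \<open>Gx\<close> are written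
    exactly as the product rules produce them, including terms such as
    \<open>0 * u p\<close>.\<close>
  define F where "F = (\<lambda>p. - (w p * dx u p + v p * dy u p + (- \<beta> * snd p) * v p))"
  define G where "G = (\<lambda>p. - (w p * dx v p + v p * dy v p + (\<beta> * snd p) * u p))"
  define Fy where "Fy = (\<lambda>p. - ((dy u p * dx u p + dy (dx u) p * w p) +
      (dy v p * dy u p + dy (dy u) p * v p) + (- \<beta> * v p + dy v p * (- \<beta> * snd p))))"
  define Gx where "Gx = (\<lambda>p. - ((dx u p * dx v p + dx (dx v) p * w p) +
      (dx v p * dy v p + dx (dy v) p * v p) + (0 * u p + dx u p * (\<beta> * snd p))))"
  \<comment> \<open>\<open>P\<close> is only assumed to have first partial derivatives; its mixed
    ones exist because \<open>F\<close> and \<open>G\<close> are differentiable.\<close>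
  have "has_dx P F"
  proof (rule has_dx_cong[OF has_partialsD(1)[OF P]])
    fix q assume "q \<in> strip"
    then show "dx P q = F q"
      using mom[of "snd q" "fst q"] by (cases q) (auto simp: F_def w_def algebra_simps)
  qed simp
  moreover have "has_dy P G"
  proof (rule has_dy_cong[OF has_partialsD(2)[OF P]])
    fix q assume "q \<in> strip"
    then show "dy P q = G q"
      using mom[of "snd q" "fst q"] by (cases q) (auto simp: G_def w_def algebra_simps)
  qed simp
  moreover have "has_dy F Fy" unfolding F_def Fy_def
    by (intro has_dy_minus has_dy_add has_dy_mult u v w
        has_dy_of_y[of "\<lambda>t. - \<beta> * t" "\<lambda>t. - \<beta>"])
      (auto intro!: derivative_eq_intros)
  moreover have "has_dx G Gx" unfolding G_def Gx_def
    by (intro has_dx_minus has_dx_add has_dx_mult u v w has_dx_of_y[of "\<lambda>t. \<beta> * t"])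
  moreover have "continuous_on strip Fy" "continuous_on strip Gx"
    unfolding Fy_def Gx_def using u v w by (auto intro!: continuous_intros)
  ultimately have FG: "Fy p = Gx p" using p by (rule mixed_partials_eq)
  have minus_dyv: "- dy v q = dx u q" and minus_dxu: "- dx u q = dy v q" if "q \<in> strip" for q
    using div[OF that] by simp_all
  \<comment> \<open>Differentiating incompressibility turns the mixed derivatives of
    \<open>u\<close> and \<open>v\<close> into pure ones, which complete the two Laplacians.\<close>
  have "has_dy (dx u) (\<lambda>p. - dy (dy v) p)"
    by (rule has_dy_cong[OF has_dy_minus[OF v(12)] minus_dyv refl])
  then have uxy: "dy (dx u) p = - dy (dy v) p" using p by (rule dy_eqI)
  have "has_dx (dy v) (\<lambda>p. - dx (dx u) p)"
    by (rule has_dx_cong[OF has_dx_minus[OF u(6)] minus_dxu refl])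
  then have vxy: "dx (dy v) p = - dx (dx u) p" using p by (rule dx_eqI)
  have vy: "dy v p = - dx u p" using div[OF p] by simp
  show "(u p - c) * laplacian v p = v p * (laplacian u p - \<beta>)"
    using FG unfolding Fy_def Gx_def uxy vxy vy w_def laplacian_def
    by (simp add: algebra_simps)
qed

section \<open>The Couette-Poiseuille curvature bound and the conclusion for traveling waves\<close>

lemma deriv_deriv_u_cp: "deriv (deriv (u_cp \<Gamma>)) y = 2 - 2 * \<Gamma>"
proof -
  have "deriv (u_cp \<Gamma>) = (\<lambda>y. \<Gamma> + (1 - \<Gamma>) * (2 * y))"
    unfolding u_cp_def[abs_def]
    by (intro ext DERIV_imp_deriv) (auto intro!: derivative_eq_intros)
  then show ?thesis
    by (simp only:) (auto intro!: DERIV_imp_deriv derivative_eq_intros)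
qed

theorem proposition6p1:
  fixes L \<Gamma> \<beta> c :: real and u v :: "real \<times> real \<Rightarrow> real"
  assumes "L > 0" and "\<Gamma> < 1" and "0 \<le> \<beta>" and "\<beta> < 2 - 2 * \<Gamma>"
    and "x_periodic L u" and "x_periodic L v"
    and "C2_strip u" and "C2_strip v"
    and "beta_plane_solution L \<beta> (traveling_wave c u) (traveling_wave c v)"
    and "C0_norm (\<lambda>(x, y). laplacian u (x, y) - deriv (deriv (u_cp \<Gamma>)) y) < 2 - 2 * \<Gamma> - \<beta>"
  shows "shear_flow (traveling_wave c u) (traveling_wave c v)"
proof -
  note u = C1_stripD[OF C2_stripD(1)[OF assms(7)]] C1_stripD[OF C2_stripD(2)[OF assms(7)]]
    C1_stripD[OF C2_stripD(3)[OF assms(7)]]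
  note v = C1_stripD[OF C2_stripD(1)[OF assms(8)]] C1_stripD[OF C2_stripD(2)[OF assms(8)]]
    C1_stripD[OF C2_stripD(3)[OF assms(8)]]
  have partials: "has_partials f" "has_partials (dx f)" "has_partials (dy f)" if "C2_strip f" for f
    using that by (auto simp: C2_strip_def C1_strip_def)
  have per_lap: "x_periodic L (laplacian f)" if "C2_strip f" "x_periodic L f" for f
    using x_periodic_dx[OF x_periodic_dx[OF that(2)]] x_periodic_dy[OF x_periodic_dy[OF that(2)]]
      partials[OF that(1)]
    by (simp add: x_periodic_def laplacian_def)
  have cont_lap: "continuous_on strip (laplacian u)" "continuous_on strip (laplacian v)"
    unfolding laplacian_def[abs_def] using u v by (auto intro!: continuous_intros)
  define f where "f = (\<lambda>p. laplacian u p - (2 - 2 * \<Gamma>))"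
  have "(\<lambda>(x, y). laplacian u (x, y) - deriv (deriv (u_cp \<Gamma>)) y) = f"
    by (auto simp: f_def deriv_deriv_u_cp)
  then have norm: "C0_norm f < 2 - 2 * \<Gamma> - \<beta>" using assms(10) by simp
  \<comment> \<open>Boundedness makes the supremum in \<open>C0_norm\<close> an actual pointwise
    bound.\<close>
  obtain B where B: "\<And>q. q \<in> strip \<Longrightarrow> \<bar>f q\<bar> \<le> B"
    by (rule x_periodic_abs_bound[of L f])
      (use assms(1) per_lap[OF assms(7,5)] cont_lap in
        \<open>auto simp: f_def x_periodic_def intro!: continuous_intros\<close>)
  have lap: "laplacian u p > \<beta>" if "p \<in> strip" for p
  proof -
    have "\<bar>f p\<bar> \<le> C0_norm f"
      unfolding C0_norm_def using that B by (intro cSUP_upper bdd_aboveI2)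
    then show ?thesis using norm by (simp add: f_def)
  qed
  note ray = traveling_wave_rayleigh[OF assms(7-9)]
  \<comment> \<open>By \<open>lap\<close> the denominator is positive, so this quotient is
    continuous also where \<open>u = c\<close>; \<open>v = (u - c) \<theta>\<close> is then the
    vorticity equation.\<close>
  define \<theta> where "\<theta> = (\<lambda>p. laplacian v p / (laplacian u p - \<beta>))"
  interpret rayleigh_strip L \<beta> "\<lambda>p. u p - c" "dx u" "dy u" "dx (dx u)" "dy (dy u)"
    v "dx v" "dy v" "dx (dx v)" "dy (dy v)" \<theta>
  proof
    show "has_dx (\<lambda>p. u p - c) (dx u)" "has_dy (\<lambda>p. u p - c) (dy u)"
      using u(1,2) by (auto simp: has_dx_def has_dy_def intro!: derivative_eq_intros)
    show "x_periodic L (\<lambda>p. u p - c)" using assms(5) by (simp add: x_periodic_def)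
    show "x_periodic L (dy u)" using x_periodic_dy assms(5) partials[OF assms(7)] by simp
    show "x_periodic L \<theta>"
      using per_lap[OF assms(7,5)] per_lap[OF assms(8,6)] by (simp add: x_periodic_def \<theta>_def)
    show "continuous_on strip \<theta>"
      unfolding \<theta>_def using cont_lap lap by (force intro!: continuous_intros)
    fix p assume p: "p \<in> strip"
    show "\<beta> < dx (dx u) p + dy (dy u) p" using lap[OF p] by (simp add: laplacian_def)
    show "dx (dx v) p + dy (dy v) p = \<theta> p * (dx (dx u) p + dy (dy u) p - \<beta>)"
      using lap[OF p] by (simp add: \<theta>_def laplacian_def)
    show "v p = (u p - c) * \<theta> p"
      using lap[OF p] ray(4)[OF p] by (simp add: \<theta>_def field_simps)
  qed (use assms(1,3) u v ray in \<open>auto intro!: continuous_intros\<close>)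
  have "v p = 0" if "p \<in> strip" for p using v_vanishes ray(3) that by blast
  then show ?thesis by (auto simp: shear_flow_def traveling_wave_def)
qed

end
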